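(* For each $n\ge 1$ let $(X^n_t)_{t\ge 0}$ be the continuous time random walk on the hypercube $\{0,1\}^n$ that jumps at rate $1$ and that, at each jump, changes the value of one coordinate chosen uniformly at random from the $n$ coordinates. Let $D^n_t$ be the number of coordinates in which $X^n_t$ and $X^n_0$ disagree. Then for every fixed $t>0$, as $n\to\infty$, $$\frac1n D^n_{nt}\to \frac{1-e^{-2t}}{2}\quad\text{in probability.}$$
   Context: The walk jumps at the times of a rate $1$ Poisson process, and the coordinates flipped at successive jumps are i.i.d. uniform on $\{1,\dots,n\}$, independent of the jump times. $D^n_t$ is the graph distance on the hypercube between $X^n_t$ and its starting point. *)

theory Defs
  imports "HOL-Probability.Probability"
begin

text \<open>
  A Poisson process of rate \<open>r\<close> is given by its counting process: \<open>N t\<close> is the number of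
  points in \<open>(0, t]\<close>. Only times \<open>t \<ge> 0\<close> are meaningful. The subtraction below is on natural
  numbers, which is harmless because the paths are nondecreasing.
\<close>

definition poisson_process :: "'a measure \<Rightarrow> real \<Rightarrow> (real \<Rightarrow> 'a \<Rightarrow> nat) \<Rightarrow> bool" where
  "poisson_process M r N \<longleftrightarrow>
     prob_space M \<and>
     (\<forall>t\<ge>0. N t \<in> M \<rightarrow>\<^sub>M count_space UNIV) \<and>
     (\<forall>\<omega>\<in>space M. N 0 \<omega> = 0 \<and> mono_on {0..} (\<lambda>t. N t \<omega>) \<and>
        (\<forall>t\<ge>0. continuous (at_right t) (\<lambda>s. N s \<omega>))) \<and>
     (\<forall>(\<tau> :: nat \<Rightarrow> real) m. 0 \<le> \<tau> 0 \<longrightarrow> mono \<tau> \<longrightarrow>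
        prob_space.indep_vars M (\<lambda>_. count_space UNIV)
          (\<lambda>i \<omega>. N (\<tau> (Suc i)) \<omega> - N (\<tau> i) \<omega>) {..<m}) \<and>
     (\<forall>s t. 0 \<le> s \<longrightarrow> s < t \<longrightarrow>
        distr M (count_space UNIV) (\<lambda>\<omega>. N t \<omega> - N s \<omega>) = measure_pmf (poisson_pmf (r * (t - s))))"

definition hypercube :: "nat \<Rightarrow> (nat \<Rightarrow> nat) set" where
  "hypercube n = {1..n} \<rightarrow>\<^sub>E {0, 1}"

definition flip :: "nat \<Rightarrow> (nat \<Rightarrow> nat) \<Rightarrow> (nat \<Rightarrow> nat)" where
  "flip i x = x(i := 1 - x i)"

primrec flips :: "(nat \<Rightarrow> nat) \<Rightarrow> (nat \<Rightarrow> nat) \<Rightarrow> nat \<Rightarrow> (nat \<Rightarrow> nat)" where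
  "flips x c 0 = x"
| "flips x c (Suc k) = flip (c k) (flips x c k)"

text \<open>
  In the walk, \<open>N t\<close> is the number of jumps up to time \<open>t\<close> and \<open>\<xi> k\<close> is the coordinate flipped
  at the jump number \<open>k + 1\<close>. The starting point, the jump times and the flipped
  coordinates are mutually independent. This is stated for the generated \<open>\<sigma>\<close>-algebras, because
  \<open>indep_vars\<close> needs random variables of one type. The law of the starting point is arbitrary.
\<close>

definition hypercube_walk ::
    "nat \<Rightarrow> 'a measure \<Rightarrow> (real \<Rightarrow> 'a \<Rightarrow> (nat \<Rightarrow> nat)) \<Rightarrow> bool" where
  "hypercube_walk n M X \<longleftrightarrow>
     prob_space M \<and>
     (\<forall>t\<ge>0. X t \<in> M \<rightarrow>\<^sub>M count_space (hypercube n)) \<and>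
     (\<exists>(N :: real \<Rightarrow> 'a \<Rightarrow> nat) (\<xi> :: nat \<Rightarrow> 'a \<Rightarrow> nat).
        poisson_process M 1 N \<and>
        prob_space.indep_vars M (\<lambda>_. count_space UNIV) \<xi> UNIV \<and>
        (\<forall>k. distr M (count_space UNIV) (\<xi> k) = measure_pmf (pmf_of_set {1..n})) \<and>
        prob_space.indep_sets M
          ((!) [sets (vimage_algebra (space M) (X 0) (count_space (hypercube n))),
                sets (vimage_algebra (space M) (\<lambda>\<omega>. \<lambda>t\<in>{0..}. N t \<omega>) (\<Pi>\<^sub>M t\<in>{0..}. count_space UNIV)),
                sets (vimage_algebra (space M) (\<lambda>\<omega> k. \<xi> k \<omega>) (\<Pi>\<^sub>M k\<in>UNIV. count_space UNIV))])
          {..<3} \<and>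
        (AE \<omega> in M. \<forall>t\<ge>0. X t \<omega> = flips (X 0 \<omega>) (\<lambda>k. \<xi> k \<omega>) (N t \<omega>)))"

definition walk_distance :: "nat \<Rightarrow> (real \<Rightarrow> 'a \<Rightarrow> (nat \<Rightarrow> nat)) \<Rightarrow> real \<Rightarrow> 'a \<Rightarrow> nat" where
  "walk_distance n X t \<omega> = card {i \<in> {1..n}. X t \<omega> i \<noteq> X 0 \<omega> i}"

text \<open>Convergence in probability to a constant; the \<open>n\<close>-th variable lives on its own space \<open>M n\<close>.\<close>

definition tendsto_in_prob ::
    "(nat \<Rightarrow> 'a measure) \<Rightarrow> (nat \<Rightarrow> 'a \<Rightarrow> real) \<Rightarrow> real \<Rightarrow> bool" where
  "tendsto_in_prob M Y c \<longleftrightarrow>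
     (\<forall>\<epsilon>>0. (\<lambda>n. measure (M n) {\<omega> \<in> space (M n). \<bar>Y n \<omega> - c\<bar> > \<epsilon>}) \<longlonglongrightarrow> 0)"

end

theory Submission
  imports Defs
begin

text \<open>
  Let \<open>s\<^sub>i\<close> be \<open>-1\<close> or \<open>1\<close> according to whether coordinate \<open>i\<close> was flipped an odd or an even
  number of times, so that \<open>n - 2 D = (\<Sum>i. s\<^sub>i)\<close>. Each \<open>s\<^sub>i\<close>, and each \<open>s\<^sub>i s\<^sub>j\<close>, is a product of
  \<open>N (n t)\<close> i.i.d. factors, of mean \<open>1 - 2 / n\<close> and \<open>1 - 4 / n\<close> (for \<open>i \<noteq> j\<close>) respectively. The
  generating function of the Poisson law gives \<open>E s\<^sub>i = exp (- 2 t)\<close> and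
  \<open>E (s\<^sub>i s\<^sub>j) = exp (- 4 t) = E s\<^sub>i * E s\<^sub>j\<close>: the signs are uncorrelated, the variance of their mean
  is at most \<open>1 / n\<close>, and Chebyshev's inequality concludes.
\<close>

section \<open>Products of a Poisson number of i.i.d. factors\<close>

text \<open>The walk states independence for the \<sigma>-algebras of the whole path and of the
  whole coordinate sequence; variables measurable with respect to these generate smaller
  \<sigma>-algebras and inherit it.\<close>

lemma (in prob_space) indep_var_if_indep_set:
  assumes indep: "indep_set (sets F) (sets G)"
    and space: "space F = space M" "space G = space M"
    and f: "f \<in> F \<rightarrow>\<^sub>M S" and g: "g \<in> G \<rightarrow>\<^sub>M T"
  shows "indep_var S f T g"
proof -
  have ev: "sets F \<subseteq> events" "sets G \<subseteq> events"
    using indep by (auto simp: indep_sets2_eq)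
  have "sigma_sets (space M) {f -` A \<inter> space M |A. A \<in> sets S} \<subseteq> sets F"
    unfolding space(1)[symmetric] by (rule sets.sigma_sets_subset) (use measurable_sets[OF f] in auto)
  moreover have "sigma_sets (space M) {g -` A \<inter> space M |A. A \<in> sets T} \<subseteq> sets G"
    unfolding space(2)[symmetric] by (rule sets.sigma_sets_subset) (use measurable_sets[OF g] in auto)
  moreover have "f \<in> M \<rightarrow>\<^sub>M S" "g \<in> M \<rightarrow>\<^sub>M T"
    using f g space ev by (auto simp: measurable_def)
  ultimately show ?thesis
    using indep unfolding indep_var_eq indep_sets2_eq by blast
qed

text \<open>Split over the events \<open>K = m\<close>: there the product has \<open>m\<close>
  independent factors and mean \<open>\<mu> ^ m\<close>, independently of \<open>K\<close>. Summing
  against the Poisson weights gives the generating function of the Poisson law at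
  \<open>\<mu>\<close>.\<close>

lemma (in prob_space) expectation_prod_poisson:
  fixes g :: "nat \<Rightarrow> real" and K :: "'a \<Rightarrow> nat" and \<xi> :: "nat \<Rightarrow> 'a \<Rightarrow> nat"
  assumes indep: "indep_set (sets F) (sets G)" "space F = space M" "space G = space M"
    and K_F: "K \<in> F \<rightarrow>\<^sub>M count_space UNIV" and \<xi>_G: "\<And>k. \<xi> k \<in> G \<rightarrow>\<^sub>M count_space UNIV"
    and iid: "indep_vars (\<lambda>_. count_space UNIV) \<xi> UNIV"
    and K: "distr M (count_space UNIV) K = measure_pmf (poisson_pmf l)" "l > 0"
    and mean: "\<And>k. expectation (\<lambda>\<omega>. g (\<xi> k \<omega>)) = \<mu>"
    and bound: "\<And>i. \<bar>g i\<bar> \<le> 1"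
  shows "expectation (\<lambda>\<omega>. \<Prod>k<K \<omega>. g (\<xi> k \<omega>)) = exp (l * (\<mu> - 1))"
proof -
  let ?P = "\<lambda>m \<omega>. \<Prod>k<m. g (\<xi> k \<omega>)"
  let ?f = "\<lambda>m \<omega>. indicator {m} (K \<omega>) * ?P m \<omega>"
  have K_meas [measurable]: "K \<in> M \<rightarrow>\<^sub>M count_space UNIV"
    by (rule indep_var_rv1[OF indep_var_if_indep_set[OF indep K_F \<xi>_G]])
  have \<xi>_meas [measurable]: "\<xi> k \<in> M \<rightarrow>\<^sub>M count_space UNIV" for k
    using iid by (auto simp: indep_vars_def)
  have P_bound: "\<bar>?P m \<omega>\<bar> \<le> 1" for m \<omega>
    by (auto simp: abs_prod intro!: prod_le_1 bound)
  have int_P: "integrable M (?P m)" for m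
    by (rule integrable_const_bound[where B = 1]) (use P_bound in auto)
  have int_ind: "integrable M (\<lambda>\<omega>. indicator {m} (K \<omega>) :: real)" for m
    by (rule integrable_const_bound[where B = 1]) (auto simp: indicator_def)
  have int_f: "integrable M (?f m)" for m
    by (rule integrable_const_bound[where B = 1]) (use P_bound in \<open>auto simp: indicator_def\<close>)
  have prob_K: "expectation (\<lambda>\<omega>. indicator {m} (K \<omega>)) = l ^ m / fact m * exp (- l)" for m
  proof -
    have "expectation (\<lambda>\<omega>. indicator {m} (K \<omega>) :: real) =
        (\<integral>x. indicator {m} x \<partial>distr M (count_space UNIV) K)"
      by (rule integral_distr[OF K_meas, symmetric]) simp
    also have "\<dots> = pmf (poisson_pmf l) m"
      by (simp add: K(1) measure_pmf_single)
    finally show ?thesis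
      using K(2) by simp
  qed
  have E_P: "expectation (?P m) = \<mu> ^ m" for m
  proof (cases "m = 0")
    case True
    then show ?thesis by (simp add: prob_space)
  next
    case False
    have "indep_vars (\<lambda>_. borel) (\<lambda>k \<omega>. g (\<xi> k \<omega>)) {..<m}"
      by (rule indep_vars_compose2[OF indep_vars_subset[OF iid]]) auto
    then have "expectation (?P m) = (\<Prod>k<m. expectation (\<lambda>\<omega>. g (\<xi> k \<omega>)))"
      by (intro indep_vars_lebesgue_integral)
        (use bound in \<open>auto intro!: integrable_const_bound[where B = 1]\<close>)
    then show ?thesis by (simp add: mean)
  qed
  have E_f: "expectation (?f m) = l ^ m / fact m * exp (- l) * \<mu> ^ m" for m
  proof -
    have "indep_var borel (\<lambda>\<omega>. indicator {m} (K \<omega>) :: real) borel (?P m)"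
    proof (rule indep_var_if_indep_set[OF indep])
      show "(\<lambda>\<omega>. indicator {m} (K \<omega>) :: real) \<in> borel_measurable F"
        using K_F by (rule measurable_compose) simp
      show "?P m \<in> borel_measurable G"
        by (intro borel_measurable_prod measurable_compose[OF \<xi>_G]) simp
    qed
    then have "expectation (?f m) = expectation (\<lambda>\<omega>. indicator {m} (K \<omega>)) * expectation (?P m)"
      using int_P[of m] int_ind[of m]
      by (subst indep_var_lebesgue_integral[symmetric]) auto
    then show ?thesis
      by (simp add: prob_K E_P)
  qed
  have f_zero: "?f m \<omega> = 0" if "m \<noteq> K \<omega>" for m \<omega>
    using that by auto
  \<comment> \<open>At each point only the term \<open>m = K \<omega>\<close> can be nonzero. As
    \<open>\<bar>?P m \<omega>\<bar> \<le> 1\<close>, the expected absolute values are dominated by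
    the Poisson weights, so expectation and series may be exchanged.\<close>
  have "(\<lambda>m. expectation (?f m)) sums expectation (\<lambda>\<omega>. \<Sum>m. ?f m \<omega>)"
  proof (rule sums_integral[OF int_f])
    show "AE \<omega> in M. summable (\<lambda>m. norm (?f m \<omega>))"
    proof (rule AE_I2)
      fix \<omega>
      show "summable (\<lambda>m. norm (?f m \<omega>))"
        by (rule summable_finite[of "{K \<omega>}"]) auto
    qed
    have "summable (\<lambda>m. l ^ m / fact m * exp (- l))"
      using summable_exp[of l] by (intro summable_mult2) (simp add: field_simps)
    then show "summable (\<lambda>m. expectation (\<lambda>\<omega>. norm (?f m \<omega>)))"
    proof (rule summable_comparison_test'[where N = 0])
      fix m :: nat
      have "expectation (\<lambda>\<omega>. norm (?f m \<omega>)) \<le> expectation (\<lambda>\<omega>. indicator {m} (K \<omega>))"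
        by (rule integral_mono[OF integrable_norm[OF int_f] int_ind])
          (use P_bound in \<open>auto simp: indicator_def\<close>)
      then show "norm (expectation (\<lambda>\<omega>. norm (?f m \<omega>))) \<le> l ^ m / fact m * exp (- l)"
        by (simp add: prob_K)
    qed
  qed
  moreover have "(\<Sum>m. ?f m \<omega>) = ?P (K \<omega>) \<omega>" for \<omega>
    using suminf_finite[of "{K \<omega>}" "\<lambda>m. ?f m \<omega>"] f_zero by simp
  ultimately have 1: "(\<lambda>m. l ^ m / fact m * exp (- l) * \<mu> ^ m) sums
      expectation (\<lambda>\<omega>. \<Prod>k<K \<omega>. g (\<xi> k \<omega>))"
    by (simp add: E_f)
  have "(\<lambda>m. exp (- l) * ((l * \<mu>) ^ m /\<^sub>R fact m)) sums (exp (- l) * exp (l * \<mu>))"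
    by (intro sums_mult exp_converges)
  moreover have "exp (- l) * ((l * \<mu>) ^ m /\<^sub>R fact m) = l ^ m / fact m * exp (- l) * \<mu> ^ m" for m
    by (simp add: power_mult_distrib field_simps)
  moreover have "exp (- l) * exp (l * \<mu>) = exp (l * (\<mu> - 1))"
    by (simp add: exp_add[symmetric] algebra_simps)
  ultimately show ?thesis
    using sums_unique2[OF 1] by simp
qed

section \<open>Signs recording the parity of flips\<close>

text \<open>The factor that one flip of coordinate \<open>j\<close> contributes to the sign of
  coordinate \<open>i\<close>.\<close>

definition flip_sign :: "nat \<Rightarrow> nat \<Rightarrow> real" where
  "flip_sign i j = (if j = i then -1 else 1)"

lemma abs_flip_sign [simp]: "\<bar>flip_sign i j\<bar> = 1"
  by (simp add: flip_sign_def)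

text \<open>One term is -1 instead of 1. Divided by \<open>n\<close>, this is the mean of a factor
  at a uniform coordinate.\<close>

lemma sum_flip_sign:
  assumes "i \<in> {1..n}"
  shows "(\<Sum>j = 1..n. flip_sign i j) = real n - 2"
proof -
  have "(\<Sum>j = 1..n. flip_sign i j) = (\<Sum>j = 1..n. 1 - 2 * (if j = i then 1 else 0))"
    by (intro sum.cong) (auto simp: flip_sign_def)
  then show ?thesis
    using assms by (simp add: sum_subtractf sum_distrib_left[symmetric])
qed

lemma sum_flip_sign_mult:
  assumes "i \<in> {1..n}" "j \<in> {1..n}" "i \<noteq> j"
  shows "(\<Sum>k = 1..n. flip_sign i k * flip_sign j k) = real n - 4"
proof -
  \<comment> \<open>For \<open>i \<noteq> j\<close> at least one of the two signs \<open>a\<close>,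
    \<open>b\<close> is 1, so \<open>(a - 1) * (b - 1) = 0\<close>, that is
    \<open>a * b = a + b - 1\<close>.\<close>
  have "(\<Sum>k = 1..n. flip_sign i k * flip_sign j k) = (\<Sum>k = 1..n. flip_sign i k + flip_sign j k - 1)"
    using \<open>i \<noteq> j\<close> by (intro sum.cong) (auto simp: flip_sign_def)
  then show ?thesis
    using assms sum_flip_sign[of i n] sum_flip_sign[of j n] by (simp add: sum.distrib sum_subtractf)
qed

lemma flips_le_1: "x i \<le> 1 \<Longrightarrow> flips x c k i \<le> 1"
  by (induction k) (auto simp: flip_def)

text \<open>Each flip of coordinate \<open>i\<close> changes both the sign and whether
  \<open>i\<close> disagrees with its start. Natural subtraction makes \<open>1 - x i\<close> an
  exchange of 0 and 1 only when \<open>x i \<le> 1\<close>.\<close>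

lemma prod_flip_sign:
  assumes "x i \<le> 1"
  shows "(\<Prod>m<k. flip_sign i (c m)) = 1 - 2 * of_bool (flips x c k i \<noteq> x i)"
proof (induction k)
  case (Suc k)
  have "flips x c k i = 0 \<or> flips x c k i = 1" "x i = 0 \<or> x i = 1"
    using assms flips_le_1[of x i c k] by auto
  then show ?case
    using Suc by (auto simp: flip_def flip_sign_def)
qed simp

text \<open>The pathwise form of \<open>n - 2 D = (\<Sum>i. s i)\<close>, solved for
  \<open>D / n\<close> so that the mean sign takes the place of \<open>exp (- 2 * t)\<close> in the
  limit.\<close>

lemma mean_prod_flip_sign:
  assumes "x \<in> hypercube n" "n \<ge> 1"
  shows "1 / real n * real (card {i \<in> {1..n}. flips x c k i \<noteq> x i}) =
    (1 - (\<Sum>i = 1..n. \<Prod>m<k. flip_sign i (c m)) / real n) / 2"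
proof -
  have "(\<Sum>i = 1..n. \<Prod>m<k. flip_sign i (c m)) =
      (\<Sum>i = 1..n. 1 - 2 * of_bool (flips x c k i \<noteq> x i))"
  proof (rule sum.cong)
    fix i assume "i \<in> {1..n}"
    then have "x i \<in> {0, 1}"
      using assms by (auto simp: hypercube_def)
    then show "(\<Prod>m<k. flip_sign i (c m)) = 1 - 2 * of_bool (flips x c k i \<noteq> x i)"
      by (intro prod_flip_sign) auto
  qed simp
  also have "\<dots> = real n - 2 * real (card {i \<in> {1..n}. flips x c k i \<noteq> x i})"
    by (simp add: sum_subtractf sum_distrib_left[symmetric] of_bool_def sum.If_cases Int_def)
  finally show ?thesis
    using \<open>n \<ge> 1\<close> by (simp add: field_simps)
qed

section \<open>Second moment estimate for a fixed dimension\<close>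

lemma hypercube_walk_deviation:
  assumes walk: "hypercube_walk n M X" and n: "n \<ge> 1" and t: "t > 0" and e: "e > 0"
  shows "measure M {\<omega> \<in> space M.
      \<bar>1 / real n * real (walk_distance n X (real n * t) \<omega>) - (1 - exp (- 2 * t)) / 2\<bar> > e}
    \<le> 1 / (4 * e\<^sup>2 * real n)"
proof -
  interpret prob_space M
    using walk by (simp add: hypercube_walk_def)
  obtain N :: "real \<Rightarrow> 'a \<Rightarrow> nat" and \<xi> :: "nat \<Rightarrow> 'a \<Rightarrow> nat"
    where N: "poisson_process M 1 N"
      and iid: "indep_vars (\<lambda>_. count_space UNIV) \<xi> UNIV"
      and \<xi>: "\<And>k. distr M (count_space UNIV) (\<xi> k) = measure_pmf (pmf_of_set {1..n})"
      and indep: "indep_sets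
          ((!) [sets (vimage_algebra (space M) (X 0) (count_space (hypercube n))),
                sets (vimage_algebra (space M) (\<lambda>\<omega>. \<lambda>t\<in>{0..}. N t \<omega>) (\<Pi>\<^sub>M t\<in>{0..}. count_space UNIV)),
                sets (vimage_algebra (space M) (\<lambda>\<omega> k. \<xi> k \<omega>) (\<Pi>\<^sub>M k\<in>UNIV. count_space UNIV))])
          {..<3}"
      and X: "AE \<omega> in M. \<forall>t\<ge>0. X t \<omega> = flips (X 0 \<omega>) (\<lambda>k. \<xi> k \<omega>) (N t \<omega>)"
    using walk unfolding hypercube_walk_def by blast
  have X0: "X 0 \<in> M \<rightarrow>\<^sub>M count_space (hypercube n)"
    using walk by (simp add: hypercube_walk_def)
  define K where "K = N (real n * t)"
  have nt: "real n * t > 0"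
    using n t by simp
  have K_meas [measurable]: "K \<in> M \<rightarrow>\<^sub>M count_space UNIV"
    using N nt by (simp add: poisson_process_def K_def)
  have \<xi>_meas [measurable]: "\<xi> k \<in> M \<rightarrow>\<^sub>M count_space UNIV" for k
    using iid by (auto simp: indep_vars_def)
  \<comment> \<open>The Poisson law is given for increments; since \<open>N 0 = 0\<close>, the
    increment from time 0 is \<open>K\<close> itself.\<close>
  have K_distr: "distr M (count_space UNIV) K = measure_pmf (poisson_pmf (real n * t))"
  proof -
    have "distr M (count_space UNIV) (\<lambda>\<omega>. N (real n * t) \<omega> - N 0 \<omega>) =
        measure_pmf (poisson_pmf (1 * (real n * t - 0)))"
      using N nt unfolding poisson_process_def by blast
    moreover have "distr M (count_space UNIV) (\<lambda>\<omega>. N (real n * t) \<omega> - N 0 \<omega>) =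
        distr M (count_space UNIV) K"
      using N by (intro distr_cong) (auto simp: poisson_process_def K_def)
    ultimately show ?thesis by simp
  qed
  define path where "path =
    vimage_algebra (space M) (\<lambda>\<omega>. \<lambda>t\<in>{0..}. N t \<omega>) (\<Pi>\<^sub>M t\<in>{0::real..}. count_space (UNIV :: nat set))"
  define coord where "coord =
    vimage_algebra (space M) (\<lambda>\<omega> k. \<xi> k \<omega>) (\<Pi>\<^sub>M k\<in>(UNIV :: nat set). count_space (UNIV :: nat set))"
  have space_eq: "space path = space M" "space coord = space M"
    by (simp_all add: path_def coord_def)
  \<comment> \<open>In the list of three \<sigma>-algebras, index 1 is \<open>path\<close> and index
    2 is \<open>coord\<close>.\<close>
  have path_coord: "indep_set (sets path) (sets coord)"
  proof (rule indep_setI)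
    show "sets path \<subseteq> events" "sets coord \<subseteq> events"
      using bspec[OF conjunct1[OF indep[unfolded indep_sets_def]], of 1]
        bspec[OF conjunct1[OF indep[unfolded indep_sets_def]], of 2]
      unfolding path_def coord_def by simp_all
    show "prob (a \<inter> b) = prob a * prob b" if "a \<in> sets path" "b \<in> sets coord" for a b
      using indep_setsD[OF indep, of "{1, 2}" "\<lambda>i. if i = 1 then a else b"] that
      by (auto simp: path_def coord_def numeral_2_eq_2 Int_commute)
  qed
  \<comment> \<open>\<open>K\<close> is the projection of the path to the time \<open>n * t\<close>,
    which lies in the index set \<open>{0..}\<close>.\<close>
  have "(\<lambda>\<omega>. \<lambda>t\<in>{0..}. N t \<omega>) \<in> path \<rightarrow>\<^sub>M (\<Pi>\<^sub>M t\<in>{0::real..}. count_space (UNIV :: nat set))"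
    unfolding path_def by (rule measurable_vimage_algebra1) (auto simp: space_PiM)
  then have "(\<lambda>\<omega>. (\<lambda>t\<in>{0..}. N t \<omega>) (real n * t)) \<in> path \<rightarrow>\<^sub>M count_space UNIV"
    by (rule measurable_compose) (rule measurable_component_singleton, use nt in simp)
  then have K_path: "K \<in> path \<rightarrow>\<^sub>M count_space UNIV"
    using nt by (simp add: K_def)
  have coord: "(\<lambda>\<omega> k. \<xi> k \<omega>) \<in> coord \<rightarrow>\<^sub>M (\<Pi>\<^sub>M k\<in>UNIV. count_space UNIV)"
    unfolding coord_def by (rule measurable_vimage_algebra1) (auto simp: space_PiM)
  have \<xi>_coord: "\<xi> k \<in> coord \<rightarrow>\<^sub>M count_space UNIV" for k
    using coord by (rule measurable_compose) (rule measurable_component_singleton, simp)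
  have E_prod: "expectation (\<lambda>\<omega>. \<Prod>k<K \<omega>. g (\<xi> k \<omega>)) =
      exp (real n * t * ((\<Sum>j = 1..n. g j) / real n - 1))"
    if "\<And>j. \<bar>g j\<bar> \<le> 1" for g :: "nat \<Rightarrow> real"
  proof (rule expectation_prod_poisson[OF path_coord space_eq K_path \<xi>_coord iid K_distr nt])
    fix k
    have "expectation (\<lambda>\<omega>. g (\<xi> k \<omega>)) = (\<integral>x. g x \<partial>distr M (count_space UNIV) (\<xi> k))"
      by (rule integral_distr[OF \<xi>_meas, symmetric]) simp
    then show "expectation (\<lambda>\<omega>. g (\<xi> k \<omega>)) = (\<Sum>j = 1..n. g j) / real n"
      using n by (simp add: \<xi> integral_pmf_of_set)
  qed (rule that)

  define s where "s i \<omega> = (\<Prod>k<K \<omega>. flip_sign i (\<xi> k \<omega>))" for i \<omega>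
  define Z where "Z \<omega> = (\<Sum>i = 1..n. s i \<omega>) / real n" for \<omega>
  \<comment> \<open>The number of factors is random but takes countably many values, so
    measurability follows from that for each fixed number.\<close>
  have s_meas [measurable]: "s i \<in> borel_measurable M" for i
  proof -
    have "(\<lambda>\<omega>. (\<lambda>m \<omega>. \<Prod>k<m. flip_sign i (\<xi> k \<omega>)) (K \<omega>) \<omega>) \<in> borel_measurable M"
      by (rule measurable_compose_countable) auto
    then show ?thesis by (simp add: s_def[abs_def])
  qed
  have abs_s: "\<bar>s i \<omega>\<bar> = 1" for i \<omega>
    by (simp add: s_def abs_prod)
  have int_s: "integrable M (s i)" for i
    by (rule integrable_const_bound[where B = 1]) (auto simp: abs_s)
  have int_ss: "integrable M (\<lambda>\<omega>. s i \<omega> * s j \<omega>)" for i j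
    by (rule integrable_const_bound[where B = 1]) (auto simp: abs_s abs_mult)
  \<comment> \<open>The Poisson exponent for factors of mean \<open>1 - c / n\<close>:
    \<open>c\<close> is 2 for one sign and 4 for a product of two distinct signs.\<close>
  have rate: "real n * t * ((real n - c) / real n - 1) = - c * t" for c
    using n by (simp add: field_simps)
  have E_s: "expectation (s i) = exp (- 2 * t)" if "i \<in> {1..n}" for i
    using E_prod[of "flip_sign i"] rate[of 2] by (simp only: s_def[abs_def] sum_flip_sign[OF that]) simp
  \<comment> \<open>The product of two signs is again a product over the same \<open>K\<close>
    jumps. Its mean is the square of \<open>exp (- 2 * t)\<close>, so distinct signs are
    uncorrelated.\<close>
  have E_ss: "expectation (\<lambda>\<omega>. s i \<omega> * s j \<omega>) = exp (- 4 * t)"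
    if "i \<in> {1..n}" "j \<in> {1..n}" "i \<noteq> j" for i j
    using E_prod[of "\<lambda>k. flip_sign i k * flip_sign j k"] rate[of 4]
    by (simp only: s_def prod.distrib sum_flip_sign_mult[OF that]) (simp add: abs_mult)
  have E_s2: "expectation (\<lambda>\<omega>. s i \<omega> * s i \<omega>) = 1" for i
  proof -
    have "s i \<omega> * s i \<omega> = 1" for \<omega>
      using abs_s[of i \<omega>] by (metis abs_mult_self_eq mult_1)
    then show ?thesis by (simp add: prob_space)
  qed
  have E_Z: "expectation Z = exp (- 2 * t)"
    using n by (simp add: Z_def[abs_def] int_s E_s)
  have Z2: "(Z \<omega>)\<^sup>2 = (\<Sum>i = 1..n. \<Sum>j = 1..n. s i \<omega> * s j \<omega>) / (real n)\<^sup>2" for \<omega>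
    by (simp add: Z_def power_divide power2_eq_square sum_product)
  have int_Z: "integrable M Z"
    by (simp add: Z_def[abs_def] int_s)
  have int_Z2: "integrable M (\<lambda>\<omega>. (Z \<omega>)\<^sup>2)"
    by (simp add: Z2 int_ss)
  have Z_meas [measurable]: "Z \<in> borel_measurable M"
    using int_Z by auto
  \<comment> \<open>One row of the second moment matrix: the diagonal entry 1 and
    \<open>n - 1\<close> equal entries off the diagonal.\<close>
  have E_sum_s: "(\<Sum>j = 1..n. expectation (\<lambda>\<omega>. s i \<omega> * s j \<omega>)) = 1 + (real n - 1) * exp (- 4 * t)"
    if "i \<in> {1..n}" for i
  proof -
    have "(\<Sum>j = 1..n. expectation (\<lambda>\<omega>. s i \<omega> * s j \<omega>)) =
        1 + (\<Sum>j\<in>{1..n} - {i}. exp (- 4 * t))"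
      using that by (subst sum.remove[of _ i]) (auto simp: E_s2 E_ss)
    then show ?thesis
      using that n by (simp add: of_nat_diff)
  qed
  have "expectation (\<lambda>\<omega>. (Z \<omega>)\<^sup>2) =
      (\<Sum>i = 1..n. \<Sum>j = 1..n. expectation (\<lambda>\<omega>. s i \<omega> * s j \<omega>)) / (real n)\<^sup>2"
    by (simp add: Z2 int_ss)
  also have "\<dots> = (\<Sum>i = 1..n. 1 + (real n - 1) * exp (- 4 * t)) / (real n)\<^sup>2"
    by (intro arg_cong2[where f = "(/)"] sum.cong refl E_sum_s)
  also have "\<dots> = (1 + (real n - 1) * exp (- 4 * t)) / real n"
    using n by (simp add: power2_eq_square)
  finally have E_Z2: "expectation (\<lambda>\<omega>. (Z \<omega>)\<^sup>2) = (1 + (real n - 1) * exp (- 4 * t)) / real n" .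
  have "exp (- 2 * t) ^ 2 = exp (- 4 * t)"
    by (simp add: power2_eq_square exp_add[symmetric])
  \<comment> \<open>The squared mean cancels the off-diagonal part up to order
    \<open>1 / n\<close>.\<close>
  then have "variance Z = (1 + (real n - 1) * exp (- 4 * t)) / real n - exp (- 4 * t)"
    by (simp only: variance_eq[OF int_Z int_Z2] E_Z2) (simp only: E_Z)
  also have "\<dots> = (1 - exp (- 4 * t)) / real n"
    using n by (simp add: field_simps)
  finally have var: "variance Z \<le> 1 / real n"
    using divide_right_mono[of "1 - exp (- 4 * t)" 1 "real n"] by simp

  have half_diff: "\<bar>(1 - a) / 2 - (1 - b) / 2\<bar> = \<bar>a - b\<bar> / 2" for a b :: real
    by (auto simp: abs_if field_simps)
  \<comment> \<open>Almost surely the scaled distance is \<open>(1 - Z) / 2\<close>, so a deviation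
    above \<open>e\<close> forces \<open>Z\<close> to deviate by at least \<open>2 * e\<close>; this
    is the source of the 4 in the bound.\<close>
  have "measure M {\<omega> \<in> space M.
      \<bar>1 / real n * real (walk_distance n X (real n * t) \<omega>) - (1 - exp (- 2 * t)) / 2\<bar> > e}
    \<le> prob {\<omega> \<in> space M. \<bar>Z \<omega> - expectation Z\<bar> \<ge> 2 * e}"
  proof (rule finite_measure_mono_AE)
    show "AE \<omega> in M. \<omega> \<in> {\<omega> \<in> space M.
        \<bar>1 / real n * real (walk_distance n X (real n * t) \<omega>) - (1 - exp (- 2 * t)) / 2\<bar> > e} \<longrightarrow>
      \<omega> \<in> {\<omega> \<in> space M. \<bar>Z \<omega> - expectation Z\<bar> \<ge> 2 * e}"
      using X AE_space
    proof eventually_elim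
      case (elim \<omega>)
      have "X 0 \<omega> \<in> hypercube n"
        using measurable_space[OF X0 elim(2)] by simp
      moreover have "X (real n * t) \<omega> = flips (X 0 \<omega>) (\<lambda>k. \<xi> k \<omega>) (K \<omega>)"
        unfolding K_def using elim(1) nt by (metis less_imp_le)
      ultimately have "1 / real n * real (walk_distance n X (real n * t) \<omega>) = (1 - Z \<omega>) / 2"
        using mean_prod_flip_sign[of "X 0 \<omega>" n "\<lambda>k. \<xi> k \<omega>" "K \<omega>"] n
        by (simp only: walk_distance_def Z_def s_def)
      then have "\<bar>1 / real n * real (walk_distance n X (real n * t) \<omega>) - (1 - exp (- 2 * t)) / 2\<bar>
          = \<bar>Z \<omega> - expectation Z\<bar> / 2"
        by (simp only: E_Z half_diff)
      then show ?case
        using elim(2) by simp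
    qed
  qed simp
  also have "\<dots> \<le> variance Z / (2 * e)\<^sup>2"
    using int_Z2 e by (intro Chebyshev_inequality) auto
  also have "\<dots> \<le> (1 / real n) / (2 * e)\<^sup>2"
    using var by (intro divide_right_mono) auto
  also have "\<dots> = 1 / (4 * e\<^sup>2 * real n)"
    by (simp add: power_mult_distrib)
  finally show ?thesis .
qed

section \<open>The limit of growing dimension\<close>

theorem theorem1:
  fixes M :: "nat \<Rightarrow> 'a measure"
    and X :: "nat \<Rightarrow> real \<Rightarrow> 'a \<Rightarrow> (nat \<Rightarrow> nat)"
    and t :: real
  assumes "\<And>n. n \<ge> 1 \<Longrightarrow> hypercube_walk n (M n) (X n)"
    and "t > 0"
  shows "tendsto_in_prob M (\<lambda>n \<omega>. 1 / real n * real (walk_distance n (X n) (real n * t) \<omega>))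
           ((1 - exp (- 2 * t)) / 2)"
  unfolding tendsto_in_prob_def
proof (intro allI impI)
  fix e :: real
  assume e: "e > 0"
  let ?p = "\<lambda>n. measure (M n) {\<omega> \<in> space (M n).
      \<bar>1 / real n * real (walk_distance n (X n) (real n * t) \<omega>) - (1 - exp (- 2 * t)) / 2\<bar> > e}"
  show "?p \<longlonglongrightarrow> 0"
  proof (rule tendsto_sandwich)
    show "\<forall>\<^sub>F n in sequentially. 0 \<le> ?p n"
      by simp
    show "\<forall>\<^sub>F n in sequentially. ?p n \<le> 1 / (4 * e\<^sup>2) * (1 / real n)"
      \<comment> \<open>The walk is given for \<open>n \<ge> 1\<close>, so the bound holds from
        there on.\<close>
      using eventually_ge_at_top[of 1]
      by eventually_elim (use hypercube_walk_deviation[OF assms(1) _ assms(2) e] in simp)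
    show "(\<lambda>n. 1 / (4 * e\<^sup>2) * (1 / real n)) \<longlonglongrightarrow> 0"
      by (intro tendsto_mult_right_zero lim_1_over_n)
  qed simp
qed

end
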